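(* Let $m \geq 3$ be an integer and let $G = D_{2m} = \langle a, b : a^m = b^2 = 1,\ bab^{-1} = a^{-1} \rangle$ be the dihedral group of order $2m$. Then $$M_1(\mathcal{CCC}(G)) = \begin{cases} \frac{(m-1)(m-3)^2}{8}, & \text{when } m \text{ is odd} \\ \frac{(m-2)(m-4)^2}{8}, & \text{when } m \text{ is even and } \frac{m}{2} \text{ is even} \\ \frac{(m-2)(m-4)^2}{8} + 2, & \text{when } m \text{ is even and } \frac{m}{2} \text{ is odd} \end{cases}$$ and $$M_2(\mathcal{CCC}(G)) = \begin{cases} \frac{(m-1)(m-3)^3}{32}, & \text{when } m \text{ is odd} \\ \frac{(m-2)(m-4)^3}{32}, & \text{when } m \text{ is even and } \frac{m}{2} \text{ is even} \\ \frac{(m-2)(m-4)^3}{32} + 1, & \text{when } m \text{ is even and } \frac{m}{2} \text{ is odd.} \end{cases}$$ Further, $\frac{M_2(\mathcal{CCC}(G))}{|e(\mathcal{CCC}(G))|} \geq \frac{M_1(\mathcal{CCC}(G))}{|v(\mathcal{CCC}(G))|}$, with equality when $m = 3, 4$ and $6$.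
   Context: For a finite group $G$ and $x \in G$, $x^G$ denotes the conjugacy class of $x$ in $G$. The commuting conjugacy class graph $\mathcal{CCC}(G)$ is the simple undirected graph whose vertices are the conjugacy classes of non-central elements of $G$, where two distinct vertices $x^G$ and $y^G$ are adjacent if and only if there exist $x' \in x^G$ and $y' \in y^G$ with $x'y' = y'x'$. For a finite simple graph $\Gamma$ with vertex set $v(\Gamma)$ and edge set $e(\Gamma)$, the first and second Zagreb indices are $M_1(\Gamma) = \sum_{v \in v(\Gamma)} \deg(v)^2$ and $M_2(\Gamma) = \sum_{uv \in e(\Gamma)} \deg(u)\deg(v)$. Convention: if $\Gamma$ has no edges (so $M_1(\Gamma)=M_2(\Gamma)=0$), the quotient $M_2(\Gamma)/|e(\Gamma)|$ is read as $0$. *)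

theory Defs
  imports Complex_Main "HOL-Algebra.Generated_Groups"
begin

section \<open>Finite simple graphs and their Zagreb indices\<close>

text \<open>Edges are unordered pairs, represented as two-element sets of vertices.\<close>

record 'v sgraph =
  verts :: "'v set"
  edges :: "'v set set"

definition finite_simple_graph :: "'v sgraph \<Rightarrow> bool" where
  "finite_simple_graph \<Gamma> \<longleftrightarrow>
     finite (verts \<Gamma>) \<and> (\<forall>e \<in> edges \<Gamma>. e \<subseteq> verts \<Gamma> \<and> card e = 2)"

definition vertex_degree :: "'v sgraph \<Rightarrow> 'v \<Rightarrow> nat" where
  "vertex_degree \<Gamma> v = card {e \<in> edges \<Gamma>. v \<in> e}"

definition zagreb1 :: "'v sgraph \<Rightarrow> nat" where
  "zagreb1 \<Gamma> = (\<Sum>v \<in> verts \<Gamma>. (vertex_degree \<Gamma> v)\<^sup>2)"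

text \<open>Each edge \<open>{u, v}\<close> is counted once; as \<open>u \<noteq> v\<close>, the product over the edge
  is \<open>vertex_degree \<Gamma> u * vertex_degree \<Gamma> v\<close>.\<close>

definition zagreb2 :: "'v sgraph \<Rightarrow> nat" where
  "zagreb2 \<Gamma> = (\<Sum>e \<in> edges \<Gamma>. \<Prod>v \<in> e. vertex_degree \<Gamma> v)"


section \<open>The commuting conjugacy class graph\<close>

definition conj_class :: "('a, 'b) monoid_scheme \<Rightarrow> 'a \<Rightarrow> 'a set" where
  "conj_class G x = {g \<otimes>\<^bsub>G\<^esub> x \<otimes>\<^bsub>G\<^esub> inv\<^bsub>G\<^esub> g | g. g \<in> carrier G}"

definition center :: "('a, 'b) monoid_scheme \<Rightarrow> 'a set" where
  "center G = {z \<in> carrier G. \<forall>g \<in> carrier G. z \<otimes>\<^bsub>G\<^esub> g = g \<otimes>\<^bsub>G\<^esub> z}"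

definition noncentral_classes :: "('a, 'b) monoid_scheme \<Rightarrow> 'a set set" where
  "noncentral_classes G = {conj_class G x | x. x \<in> carrier G - center G}"

definition CCC :: "('a, 'b) monoid_scheme \<Rightarrow> 'a set sgraph" where
  "CCC G = \<lparr> verts = noncentral_classes G,
             edges = {{X, Y} | X Y. X \<in> noncentral_classes G \<and> Y \<in> noncentral_classes G \<and> X \<noteq> Y \<and>
                        (\<exists>x' \<in> X. \<exists>y' \<in> Y. x' \<otimes>\<^bsub>G\<^esub> y' = y' \<otimes>\<^bsub>G\<^esub> x')} \<rparr>"

lemma finite_simple_graph_CCC:
  assumes "finite (carrier G)"
  shows "finite_simple_graph (CCC G)"
proof -
  have "finite (verts (CCC G))"
    using assms by (simp add: CCC_def noncentral_classes_def)
  moreover have "e \<subseteq> verts (CCC G) \<and> card e = 2" if e: "e \<in> edges (CCC G)" for e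
  proof -
    obtain X Y where "e = {X, Y}" "X \<in> verts (CCC G)" "Y \<in> verts (CCC G)" "X \<noteq> Y"
      using e by (auto simp: CCC_def)
    then show ?thesis by simp
  qed
  ultimately show ?thesis
    unfolding finite_simple_graph_def by blast
qed


section \<open>Dihedral groups\<close>

text \<open>The relations bound the order of a group they present by \<open>2 * m\<close>. A group generated by
  \<open>a\<close> and \<open>b\<close> subject to them is therefore the group with this presentation precisely
  when its order is \<open>2 * m\<close>. The lemma \<open>dihedral_group_exists\<close> below gives a
  model for every positive \<open>m\<close>.\<close>

definition dihedral_group :: "nat \<Rightarrow> ('a, 'b) monoid_scheme \<Rightarrow> bool" where
  "dihedral_group m G \<longleftrightarrow> group G \<and> order G = 2 * m \<and>
     (\<exists>a \<in> carrier G. \<exists>b \<in> carrier G. carrier G = generate G {a, b} \<and>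
        a [^]\<^bsub>G\<^esub> m = \<one>\<^bsub>G\<^esub> \<and> b [^]\<^bsub>G\<^esub> (2::nat) = \<one>\<^bsub>G\<^esub> \<and>
        b \<otimes>\<^bsub>G\<^esub> a \<otimes>\<^bsub>G\<^esub> inv\<^bsub>G\<^esub> b = inv\<^bsub>G\<^esub> a)"

text \<open>The pair \<open>(i, s)\<close> stands for \<open>a\<^sup>i b\<^sup>s\<close>.\<close>

definition dihedral_model :: "nat \<Rightarrow> (int \<times> bool) monoid" where
  "dihedral_model m = \<lparr> carrier = {0..<int m} \<times> UNIV,
     mult = (\<lambda>(i, s) (j, t). ((if s then i - j else i + j) mod int m, s \<noteq> t)),
     one = (0, False) \<rparr>"

lemma dihedral_group_exists:
  assumes m: "m > 0"
  shows "dihedral_group m (dihedral_model m)"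
proof -
  let ?D = "dihedral_model m"
  interpret D: group ?D
  proof (rule groupI)
    show "x \<otimes>\<^bsub>?D\<^esub> y \<otimes>\<^bsub>?D\<^esub> z = x \<otimes>\<^bsub>?D\<^esub> (y \<otimes>\<^bsub>?D\<^esub> z)" for x y z
      by (cases x; cases y; cases z) (auto simp: dihedral_model_def mod_simps algebra_simps)
    show "\<exists>y \<in> carrier ?D. y \<otimes>\<^bsub>?D\<^esub> x = \<one>\<^bsub>?D\<^esub>" if "x \<in> carrier ?D" for x
      using that m
      by (cases x, intro bexI[of _ "if snd x then x else ((- fst x) mod int m, False)"])
        (auto simp: dihedral_model_def mod_simps)
  qed (use m in \<open>auto simp: dihedral_model_def\<close>)
  have ord: "order ?D = 2 * m"
    by (simp add: order_def dihedral_model_def card_cartesian_product)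
  define a where "a = (1 mod int m, False)"
  define b where "b = (0 :: int, True)"
  have a: "a \<in> carrier ?D" and b: "b \<in> carrier ?D"
    using m by (auto simp: dihedral_model_def a_def b_def)
  have apow: "a [^]\<^bsub>?D\<^esub> k = (int k mod int m, False)" for k :: nat
    by (induction k) (auto simp: a_def dihedral_model_def nat_pow_def mod_simps algebra_simps)
  have bb: "b \<otimes>\<^bsub>?D\<^esub> b = \<one>\<^bsub>?D\<^esub>"
    by (simp add: b_def dihedral_model_def)
  then have invb: "inv\<^bsub>?D\<^esub> b = b"
    using D.inv_equality b by blast
  have "b \<otimes>\<^bsub>?D\<^esub> a \<otimes>\<^bsub>?D\<^esub> b \<otimes>\<^bsub>?D\<^esub> a = \<one>\<^bsub>?D\<^esub>"
    by (simp add: a_def b_def dihedral_model_def mod_simps)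
  then have rel: "b \<otimes>\<^bsub>?D\<^esub> a \<otimes>\<^bsub>?D\<^esub> inv\<^bsub>?D\<^esub> b = inv\<^bsub>?D\<^esub> a"
    using D.inv_equality a b invb by (metis D.m_closed)
  have gen_pow: "a [^]\<^bsub>?D\<^esub> k \<in> generate ?D {a, b}" for k :: nat
    by (induction k) (auto intro: generate.intros)
  have "x \<in> generate ?D {a, b}" if "x \<in> carrier ?D" for x
  proof -
    obtain i s where x: "x = (i, s)" by fastforce
    then have i: "0 \<le> i" "i < int m" using that by (auto simp: dihedral_model_def)
    then have ai: "a [^]\<^bsub>?D\<^esub> nat i = (i, False)" by (simp add: apow)
    then have "x = (if s then a [^]\<^bsub>?D\<^esub> nat i \<otimes>\<^bsub>?D\<^esub> b else a [^]\<^bsub>?D\<^esub> nat i)"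
      using i by (simp add: x b_def dihedral_model_def)
    then show ?thesis
      using gen_pow[of "nat i"] by (auto intro: generate.intros)
  qed
  then have "carrier ?D = generate ?D {a, b}"
    using D.generate_incl[of "{a, b}"] a b by blast
  moreover have "a [^]\<^bsub>?D\<^esub> m = \<one>\<^bsub>?D\<^esub>"
    by (simp add: apow) (simp add: dihedral_model_def)
  moreover have "b [^]\<^bsub>?D\<^esub> (2::nat) = \<one>\<^bsub>?D\<^esub>"
    using bb b by (simp add: numeral_2_eq_2)
  ultimately show ?thesis
    unfolding dihedral_group_def using D.group_axioms ord rel a b by blast
qed

end

theory Submission
  imports Defs "HOL-Library.Disjoint_Sets" "HOL-Number_Theory.Cong"
begin

text \<open>Rotations commute with each other, while no reflection commutes with a noncentral
  rotation. Hence the graph is a disjoint union of complete graphs: one on the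
  \<open>(m - 1) div 2\<close> noncentral rotation classes and the others on the reflection classes, of
  which there is one if \<open>m\<close> is odd and two if \<open>m\<close> is even. In the latter case, as \<open>a\<^sup>i b\<close> and
  \<open>a\<^sup>j b\<close> commute exactly if \<open>m\<close> divides \<open>2(i - j)\<close>, the two classes are adjacent exactly if
  \<open>m/2\<close> is odd. With \<open>k + 1\<close> rotation classes, the only nontrivial inequality (\<open>m/2\<close> odd)
  amounts to \<open>(k + 1)\<^sup>2(k - 1)\<^sup>2 \<ge> 0\<close>.\<close>

section \<open>Disjoint unions of complete graphs\<close>

text \<open>Singleton members of \<open>P\<close> are isolated vertices. In such a graph each
  invariant needed is a sum over \<open>P\<close> of a function of \<open>card C\<close> alone, so
  only the clique sizes matter.\<close>

locale clique_union =
  fixes \<Gamma> :: "'v sgraph" and P :: "'v set set"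
  assumes finite_P: "finite P"
    and finite_clique: "C \<in> P \<Longrightarrow> finite C"
    and disj: "disjoint P"
    and verts_eq: "verts \<Gamma> = \<Union>P"
    and edges_eq: "edges \<Gamma> = {e. card e = 2 \<and> (\<exists>C\<in>P. e \<subseteq> C)}"
begin

lemma edges_Union: "edges \<Gamma> = (\<Union>C\<in>P. {e. e \<subseteq> C \<and> card e = 2})"
  unfolding edges_eq by blast

lemma edges_disjoint:
  assumes "C \<in> P" "D \<in> P" "C \<noteq> D"
  shows "{e. e \<subseteq> C \<and> card e = 2} \<inter> {e. e \<subseteq> D \<and> card e = 2} = {}"
proof -
  have "C \<inter> D = {}" using disj assms by (auto simp: disjoint_def)
  show ?thesis
  proof (rule equals0I)
    fix e assume e: "e \<in> {e. e \<subseteq> C \<and> card e = 2} \<inter> {e. e \<subseteq> D \<and> card e = 2}"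
    then have "e = {}" using \<open>C \<inter> D = {}\<close> by blast
    then show False using e by simp
  qed
qed

text \<open>Disjointness makes \<open>C\<close> the only clique through \<open>v\<close>, so the
  edges at \<open>v\<close> correspond to the other vertices of \<open>C\<close>.\<close>

lemma degree:
  assumes "C \<in> P" "v \<in> C"
  shows "vertex_degree \<Gamma> v = card C - 1"
proof -
  have "D = C" if "D \<in> P" "v \<in> D" for D
    using disj assms that by (auto simp: disjoint_def)
  then have "{e \<in> edges \<Gamma>. v \<in> e} = {e. e \<subseteq> C \<and> card e = 2 \<and> v \<in> e}"
    unfolding edges_eq using assms by blast
  also have "\<dots> = (\<lambda>w. {v, w}) ` (C - {v})"
  proof (intro equalityI subsetI)
    fix e assume e: "e \<in> {e. e \<subseteq> C \<and> card e = 2 \<and> v \<in> e}"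
    then obtain w where "e = {v, w}" "w \<noteq> v" unfolding mem_Collect_eq card_2_iff by blast
    then show "e \<in> (\<lambda>w. {v, w}) ` (C - {v})" using e by auto
  qed (use assms in auto)
  finally have "vertex_degree \<Gamma> v = card ((\<lambda>w. {v, w}) ` (C - {v}))"
    by (simp add: vertex_degree_def)
  also have "\<dots> = card (C - {v})"
    by (rule card_image) (auto simp: inj_on_def doubleton_eq_iff)
  finally show ?thesis using assms finite_clique by simp
qed

lemma card_verts: "card (verts \<Gamma>) = (\<Sum>C\<in>P. card C)"
  unfolding verts_eq using disj finite_clique
  by (intro card_Union_disjoint) (simp_all add: disjoint_def pairwise_def disjnt_def)

lemma card_edges: "card (edges \<Gamma>) = (\<Sum>C\<in>P. card C choose 2)"
proof -
  have "card (edges \<Gamma>) = (\<Sum>C\<in>P. card {e. e \<subseteq> C \<and> card e = 2})"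
    unfolding edges_Union using finite_P finite_clique edges_disjoint
    by (intro card_UN_disjoint) auto
  then show ?thesis by (simp add: n_subsets finite_clique)
qed

lemma zagreb1: "zagreb1 \<Gamma> = (\<Sum>C\<in>P. card C * (card C - 1)\<^sup>2)"
proof -
  have "zagreb1 \<Gamma> = (\<Sum>C\<in>P. \<Sum>v\<in>C. (vertex_degree \<Gamma> v)\<^sup>2)"
    unfolding zagreb1_def verts_eq using disj finite_clique
    by (subst sum.Union_disjoint) (auto simp: disjoint_def)
  then show ?thesis by (simp add: degree)
qed

text \<open>Both ends of an edge lie in the same clique and so have the same degree; the product
  over an edge is therefore a square.\<close>

lemma zagreb2: "zagreb2 \<Gamma> = (\<Sum>C\<in>P. (card C choose 2) * (card C - 1)\<^sup>2)"
proof -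
  have "zagreb2 \<Gamma> = (\<Sum>C\<in>P. \<Sum>e | e \<subseteq> C \<and> card e = 2. \<Prod>v\<in>e. vertex_degree \<Gamma> v)"
    unfolding zagreb2_def edges_Union using finite_P finite_clique edges_disjoint
    by (intro sum.UNION_disjoint) auto
  also have "\<dots> = (\<Sum>C\<in>P. \<Sum>e | e \<subseteq> C \<and> card e = 2. (card C - 1)\<^sup>2)"
  proof (intro sum.cong refl)
    fix C e assume "C \<in> P" "e \<in> {e. e \<subseteq> C \<and> card e = 2}"
    then have "card e = 2" and "(\<Prod>v\<in>e. vertex_degree \<Gamma> v) = (\<Prod>v\<in>e. card C - 1)"
      using degree by (auto intro: prod.cong simp del: prod_constant)
    then show "(\<Prod>v\<in>e. vertex_degree \<Gamma> v) = (card C - 1)\<^sup>2" by simp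
  qed
  finally show ?thesis by (simp add: n_subsets finite_clique)
qed

end

section \<open>Conjugacy classes of dihedral groups\<close>

text \<open>The elements \<open>r i\<close> and \<open>t i\<close> stand for \<open>a\<^sup>i\<close> and \<open>a\<^sup>i b\<close>.\<close>

locale dihedral = group G
  for G :: "('a, 'b) monoid_scheme" (structure) +
  fixes m :: nat and r t :: "int \<Rightarrow> 'a"
  assumes m_ge: "m \<ge> 3"
    and carrier_eq: "carrier G = range r \<union> range t"
    and r_eq_iff: "r i = r j \<longleftrightarrow> [i = j] (mod int m)"
    and t_eq_iff: "t i = t j \<longleftrightarrow> [i = j] (mod int m)"
    and r_neq_t: "r i \<noteq> t j"
    and one_eq: "\<one> = r 0"
    and rr: "r i \<otimes> r j = r (i + j)"
    and rt: "r i \<otimes> t j = t (i + j)"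
    and tr: "t i \<otimes> r j = t (i - j)"
    and tt: "t i \<otimes> t j = r (i - j)"

section \<open>Normal forms in a dihedral group\<close>

lemma (in group) conj_int_pow:
  assumes "a \<in> carrier G" "b \<in> carrier G" and rel: "b \<otimes> a \<otimes> inv b = inv a"
  shows "b \<otimes> a [^] (i::int) = a [^] (- i) \<otimes> b"
proof -
  have ba: "b \<otimes> a = inv a \<otimes> b"
    using assms by (metis inv_closed inv_solve_right m_closed)
  then have ba': "b \<otimes> inv a = a \<otimes> b"
    using assms(1,2) by (metis inv_closed inv_solve_left' inv_solve_right m_assoc m_closed)
  \<comment> \<open>Moving \<open>b\<close> past a factor inverts it. A general \<open>x\<close>
    serves both signs of the exponent: \<open>a\<close> for nonnegative and \<open>inv a\<close> for
    nonpositive ones.\<close>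
  have nat_case: "b \<otimes> x [^] n = inv x [^] n \<otimes> b"
    if x: "x \<in> carrier G" and bx: "b \<otimes> x = inv x \<otimes> b" for x and n :: nat
  proof (induction n)
    case (Suc n)
    have "b \<otimes> x [^] Suc n = (b \<otimes> x [^] n) \<otimes> x" using x assms by (simp add: m_assoc)
    also have "\<dots> = inv x [^] n \<otimes> (b \<otimes> x)" using x assms Suc by (simp add: m_assoc)
    also have "\<dots> = inv x [^] Suc n \<otimes> b" using x assms bx by (simp add: m_assoc)
    finally show ?case .
  qed (use x assms in auto)
  show ?thesis
  proof (cases i rule: int_cases2)
    case (nonneg n)
    then show ?thesis
      using nat_case[OF assms(1) ba, of n] assms by (simp add: int_pow_neg int_pow_int nat_pow_inv)
  next
    case (nonpos n)
    then show ?thesis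
      using nat_case[of "inv a" n] ba' assms by (simp add: int_pow_neg int_pow_int nat_pow_inv)
  qed
qed

text \<open>The relations rewrite every element as \<open>r i\<close> or \<open>t i\<close> with i
  taken modulo m. These are at most 2m forms, so order exactly 2m forces them to be
  distinct.\<close>

lemma dihedral_group_imp_dihedral:
  fixes G :: "('a, 'b) monoid_scheme" (structure)
  assumes m: "m \<ge> 3" and "dihedral_group m G"
  obtains r t where "dihedral G m r t"
proof -
  interpret group G using assms(2) by (simp add: dihedral_group_def)
  obtain a b where a: "a \<in> carrier G" and b: "b \<in> carrier G"
    and gen: "carrier G = generate G {a, b}"
    and am: "a [^] m = \<one>" and b2: "b [^] (2::nat) = \<one>"
    and rel: "b \<otimes> a \<otimes> inv b = inv a" and ord: "order G = 2 * m"
    using assms(2) unfolding dihedral_group_def by blast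
  define r where "r i = a [^] i" for i :: int
  define t where "t i = a [^] i \<otimes> b" for i :: int
  have bb: "b \<otimes> b = \<one>" using b2 b by (simp add: numeral_2_eq_2)
  have br: "b \<otimes> r i = r (- i) \<otimes> b" for i
    unfolding r_def by (rule conj_int_pow[OF a b rel])
  have rG: "r i \<in> carrier G" and tG: "t i \<in> carrier G" for i
    using a b by (auto simp: r_def t_def)
  have t_r: "t i = r i \<otimes> b" for i by (simp add: t_def r_def)
  have rr: "r i \<otimes> r j = r (i + j)" for i j using a by (simp add: r_def int_pow_mult)
  have rt: "r i \<otimes> t j = t (i + j)" for i j
    using b rG by (simp add: t_r rr m_assoc[symmetric])
  have tr: "t i \<otimes> r j = t (i - j)" for i j
  proof -
    have "t i \<otimes> r j = r i \<otimes> (b \<otimes> r j)" using b rG by (simp add: t_r m_assoc)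
    also have "\<dots> = r i \<otimes> t (- j)" by (simp add: br t_r)
    finally show ?thesis by (simp add: rt)
  qed
  have tt: "t i \<otimes> t j = r (i - j)" for i j
  proof -
    have "t i \<otimes> t j = (t i \<otimes> r j) \<otimes> b" using b rG tG by (simp add: t_r[of j] m_assoc)
    also have "\<dots> = r (i - j)" using b rG bb by (simp add: tr) (simp add: t_r m_assoc)
    finally show ?thesis .
  qed
  have one: "\<one> = r 0" by (simp add: r_def)
  \<comment> \<open>The normal forms contain the identity, the generators and their inverses, and
    are closed under products.\<close>
  have "x \<in> range r \<union> range t" if "x \<in> generate G {a, b}" for x
    using that
  proof induction
    case one then show ?case using \<open>\<one> = r 0\<close> by auto
  next
    case (incl h)
    have "a = r 1" "b = t 0" using a b by (auto simp: r_def t_def)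
    then show ?case using incl by auto
  next
    case (inv h)
    have "inv a = r (-1)" "inv b = t 0"
      using a b bb inv_equality by (auto simp: r_def t_def int_pow_neg)
    then show ?case using inv by auto
  next
    case (eng h1 h2)
    then show ?case by (auto simp: rr rt tr tt)
  qed
  then have carr: "carrier G = range r \<union> range t" using gen rG tG by auto
  have rm: "r (int m) = \<one>" using am by (simp add: r_def int_pow_int)
  have r_mod: "r (i mod int m) = r i" for i
  proof -
    have "r (int m * k) = \<one>" for k
      using a rm by (simp add: r_def int_pow_pow[symmetric])
    then have "r i = r (i mod int m) \<otimes> \<one>"
      by (metis rr mod_mult_div_eq add.commute)
    then show ?thesis using rG by simp
  qed
  have t_mod: "t (i mod int m) = t i" for i by (simp add: t_r r_mod)
  \<comment> \<open>\<open>f\<close> will map a set of 2m pairs onto a group of order 2m, so it is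
    injective there.\<close>
  define f where "f = (\<lambda>(i, s). if s then t i else r i)"
  have "carrier G = f ` ({0..<int m} \<times> UNIV)" (is "_ = f ` ?D")
  proof
    show "carrier G \<subseteq> f ` ?D"
    proof
      fix x assume "x \<in> carrier G"
      moreover have "r i = f (i, False)" "t i = f (i, True)" for i by (simp_all add: f_def)
      ultimately obtain i s where "x = f (i, s)" using carr by (metis UnE rangeE)
      then have "x = f (i mod int m, s)" by (simp add: f_def r_mod t_mod)
      then show "x \<in> f ` ?D" using m by auto
    qed
  qed (use rG tG in \<open>auto simp: f_def\<close>)
  then have "card (f ` ?D) = card ?D" using ord by (simp add: order_def card_cartesian_product)
  then have inj: "inj_on f ?D" by (intro eq_card_imp_inj_on) auto
  have f_eq: "f (i, s) = f (j, u) \<longleftrightarrow> [i = j] (mod int m) \<and> s = u" for i j s u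
  proof -
    have "f (i, s) = f (j, u) \<longleftrightarrow> f (i mod int m, s) = f (j mod int m, u)"
      by (simp add: f_def r_mod t_mod)
    also have "\<dots> \<longleftrightarrow> (i mod int m, s) = (j mod int m, u)"
      using m by (intro inj_on_eq_iff[OF inj]) auto
    finally show ?thesis by (simp add: cong_def)
  qed
  have "dihedral G m r t"
    using m carr one rr rt tr tt f_eq[of _ False _ False] f_eq[of _ True _ True]
      f_eq[of _ False _ True]
    by unfold_locales (auto simp: f_def)
  then show thesis by (rule that)
qed

section \<open>Centre and conjugacy classes\<close>

context dihedral
begin

lemma r_closed [simp]: "r i \<in> carrier G" and t_closed [simp]: "t i \<in> carrier G"
  by (auto simp: carrier_eq)

lemma inv_r: "inv (r i) = r (- i)" and inv_t: "inv (t i) = t i"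
  by (auto intro!: inv_equality simp: rr tt one_eq)

text \<open>Conjugation by a rotation fixes \<open>r i\<close>, and conjugation by a reflection
  inverts it.\<close>

lemma r_class: "conj_class G (r i) = {r i, r (- i)}" (is "?L = ?R")
proof
  show "?L \<subseteq> ?R"
    by (auto simp: conj_class_def carrier_eq inv_r inv_t rr tr tt)
  have "r i = r 0 \<otimes> r i \<otimes> inv (r 0)" "r (- i) = t 0 \<otimes> r i \<otimes> inv (t 0)"
    by (simp_all add: inv_r inv_t rr tr tt)
  then show "?R \<subseteq> ?L" unfolding conj_class_def using r_closed t_closed by blast
qed

lemma r_class_uminus: "conj_class G (r (- i)) = conj_class G (r i)"
  by (auto simp: r_class)

text \<open>Conjugation by \<open>r k\<close> shifts the exponent by 2k. Conjugation by
  \<open>t k\<close> sends i to 2k - i = i + 2(k - i), again an even shift.\<close>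

lemma t_class: "conj_class G (t i) = {t (i + 2 * k) |k. True}" (is "?L = ?R")
proof
  show "?L \<subseteq> ?R"
  proof
    fix x assume "x \<in> ?L"
    then obtain k where "x = r k \<otimes> t i \<otimes> inv (r k) \<or> x = t k \<otimes> t i \<otimes> inv (t k)"
      by (auto simp: conj_class_def carrier_eq)
    moreover have "r k \<otimes> t i \<otimes> inv (r k) = t (i + 2 * k)" by (simp add: inv_r rt tr algebra_simps)
    moreover have "t k \<otimes> t i \<otimes> inv (t k) = t (i + 2 * (k - i))" by (simp add: inv_t rt tt)
    ultimately show "x \<in> ?R" by blast
  qed
  have "t (i + 2 * k) = r k \<otimes> t i \<otimes> inv (r k)" for k
    by (simp add: inv_r rt tr algebra_simps)
  then show "?R \<subseteq> ?L" unfolding conj_class_def using r_closed by blast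
qed

text \<open>Only reflections test centrality here: the products of \<open>r i\<close> and
  \<open>t j\<close> in the two orders are reflections with exponents i + j and j - i, which differ
  by 2i.\<close>

lemma r_central_iff: "r i \<in> center G \<longleftrightarrow> int m dvd 2 * i"
proof -
  have "r i \<in> center G \<longleftrightarrow> (\<forall>j. [i + j = j - i] (mod int m))"
    by (simp add: center_def carrier_eq ball_Un rr rt tr t_eq_iff add.commute)
  then show ?thesis by (simp add: cong_iff_dvd_diff algebra_simps)
qed

lemma t_not_central: "t i \<notin> center G"
proof
  assume "t i \<in> center G"
  then have "t i \<otimes> r 1 = r 1 \<otimes> t i" by (auto simp: center_def)
  then have "int m dvd 2"
    using dvd_minus_iff[of "int m" 2] by (simp add: tr rt t_eq_iff cong_iff_dvd_diff)
  then show False using m_ge zdvd_imp_le by fastforce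
qed

text \<open>Conjugating \<open>r i\<close> can only change the sign of i, and the exponent of the
  reflection cancels, so the obstruction 2i survives for all representatives.\<close>

lemma r_t_not_commute:
  assumes "\<not> int m dvd 2 * i" "x \<in> conj_class G (r i)" "y \<in> conj_class G (t j)"
  shows "x \<otimes> y \<noteq> y \<otimes> x"
proof -
  obtain l where y: "y = t l" using assms(3) by (auto simp: t_class)
  have "[i + l = l - i] (mod int m) \<longleftrightarrow> int m dvd 2 * i"
    "[l - i = l + i] (mod int m) \<longleftrightarrow> int m dvd - (2 * i)"
    by (simp_all add: cong_iff_dvd_diff algebra_simps)
  then show ?thesis
    using assms(1,2) by (auto simp: r_class y rt tr t_eq_iff)
qed

definition rotation_classes :: "'a set set" where
  "rotation_classes = {conj_class G (r i) |i. \<not> int m dvd 2 * i}"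

lemma noncentral_classes_eq:
  "noncentral_classes G = rotation_classes \<union> range (\<lambda>i. conj_class G (t i))"
  unfolding noncentral_classes_def rotation_classes_def
  using t_not_central r_central_iff by (auto simp: carrier_eq)

text \<open>A class is a pair of exponents i and -i modulo m, represented by i in
  \<open>{1..?n}\<close>. The residues left out, 0 and for even m also m/2, are central.\<close>

lemma card_rotation_classes: "card rotation_classes = (m - 1) div 2"
proof -
  let ?n = "int ((m - 1) div 2)"
  have n: "2 * ?n < int m" "int m \<le> 2 * ?n + 2" using m_ge by linarith+
  have "rotation_classes = (\<lambda>i. conj_class G (r i)) ` {1..?n}"
  proof
    show "rotation_classes \<subseteq> (\<lambda>i. conj_class G (r i)) ` {1..?n}"
    proof
      fix X assume "X \<in> rotation_classes"
      then obtain i where X: "X = conj_class G (r i)" and i: "\<not> int m dvd 2 * i"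
        by (auto simp: rotation_classes_def)
      define j where "j = i mod int m"
      have j: "0 \<le> j" "j < int m" using m_ge by (auto simp: j_def)
      have ij: "[i = j] (mod int m)" by (simp add: j_def cong_def)
      then have "\<not> int m dvd 2 * j"
        using i by (metis cong_dvd_iff cong_scalar_left)
      then have "j \<noteq> 0" "2 * j \<noteq> int m" by auto
      then have "j \<in> {1..?n} \<or> int m - j \<in> {1..?n}"
        using j n by auto
      moreover have "r i = r j" "r (int m - j) = r (- j)"
        using ij by (simp_all add: r_eq_iff cong_iff_dvd_diff)
      then have "X = conj_class G (r j)" "X = conj_class G (r (int m - j))"
        using X by (simp_all add: r_class_uminus)
      ultimately show "X \<in> (\<lambda>i. conj_class G (r i)) ` {1..?n}" by blast
    qed
    have "\<not> int m dvd 2 * i" if "i \<in> {1..?n}" for i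
      using that n zdvd_imp_le[of "int m" "2 * i"] by auto
    then show "(\<lambda>i. conj_class G (r i)) ` {1..?n} \<subseteq> rotation_classes"
      by (auto simp: rotation_classes_def)
  qed
  moreover have "inj_on (\<lambda>i. conj_class G (r i)) {1..?n}"
  proof (rule inj_onI)
    fix i j assume ij: "i \<in> {1..?n}" "j \<in> {1..?n}" and "conj_class G (r i) = conj_class G (r j)"
    then have "[i = j] (mod int m) \<or> int m dvd i + j"
      by (auto simp: r_class r_eq_iff doubleton_eq_iff cong_iff_dvd_diff)
    \<comment> \<open>Here 0 < i + j \<le> 2 \<open>?n\<close> < m.\<close>
    moreover have "\<not> int m dvd i + j"
      using ij n zdvd_imp_le[of "int m" "i + j"] by auto
    ultimately show "i = j"
      using ij n by (auto simp: cong_def)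
  qed
  ultimately show ?thesis by (simp add: card_image)
qed

text \<open>Conjugate reflections have exponents differing by an even number modulo m. For even m
  this fixes the parity; for odd m an odd difference becomes even after subtracting m.\<close>

lemma t_class_eq_iff:
  "conj_class G (t i) = conj_class G (t j) \<longleftrightarrow> odd m \<or> even (i - j)"
proof -
  have "conj_class G (t i) = conj_class G (t j) \<longleftrightarrow> t j \<in> conj_class G (t i)"
  proof
    assume "t j \<in> conj_class G (t i)"
    then obtain k where "[j = i + 2 * k] (mod int m)" by (auto simp: t_class t_eq_iff)
    then have "t (j + 2 * l) = t (i + 2 * (k + l))" "t (i + 2 * l) = t (j + 2 * (l - k))" for l
      by (auto simp: t_eq_iff cong_iff_dvd_diff dvd_diff_commute algebra_simps)
    then show "conj_class G (t i) = conj_class G (t j)" unfolding t_class by blast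
  next
    have "t j \<in> conj_class G (t j)" by (auto simp: t_class intro: exI[of _ 0])
    then show "conj_class G (t i) = conj_class G (t j) \<Longrightarrow> t j \<in> conj_class G (t i)" by simp
  qed
  also have "\<dots> \<longleftrightarrow> (\<exists>k. int m dvd (j - i) - 2 * k)"
    by (auto simp: t_class t_eq_iff cong_iff_dvd_diff algebra_simps)
  also have "\<dots> \<longleftrightarrow> odd m \<or> even (i - j)"
  proof
    assume "\<exists>k. int m dvd (j - i) - 2 * k"
    then obtain k where k: "int m dvd (j - i) - 2 * k" by blast
    show "odd m \<or> even (i - j)"
    proof (rule disjCI)
      assume "\<not> even (i - j)"
      show "odd m"
      proof
        assume "even m"
        then have "even ((j - i) - 2 * k)" using k by (meson dvd_trans even_of_nat)
        then show False using \<open>\<not> even (i - j)\<close> by simp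
      qed
    qed
  next
    assume "odd m \<or> even (i - j)"
    then consider "even (j - i)" | "odd (j - i)" "odd m" by auto
    then show "\<exists>k. int m dvd (j - i) - 2 * k"
    proof cases
      case 1
      then show ?thesis by (intro exI[of _ "(j - i) div 2"]) simp
    next
      case 2
      then have "even (j - i - int m)" by simp
      then show ?thesis by (intro exI[of _ "(j - i - int m) div 2"]) simp
    qed
  qed
  finally show ?thesis .
qed

lemma range_t_class: "range (\<lambda>i. conj_class G (t i)) = {conj_class G (t 0), conj_class G (t 1)}"
proof -
  have "conj_class G (t i) = conj_class G (t 0) \<or> conj_class G (t i) = conj_class G (t 1)" for i
    by (auto simp: t_class_eq_iff)
  then show ?thesis by blast
qed

text \<open>Exponents of opposite parity have an odd difference. Commuting means that m divides
  twice this difference, hence that m/2 divides an odd number.\<close>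

lemma t_class_commute_iff:
  assumes "even m"
  shows "(\<exists>x\<in>conj_class G (t 0). \<exists>y\<in>conj_class G (t 1). x \<otimes> y = y \<otimes> x) \<longleftrightarrow> odd (m div 2)"
proof -
  have "(\<exists>x\<in>conj_class G (t 0). \<exists>y\<in>conj_class G (t 1). x \<otimes> y = y \<otimes> x)
    \<longleftrightarrow> (\<exists>k l. t (0 + 2 * k) \<otimes> t (1 + 2 * l) = t (1 + 2 * l) \<otimes> t (0 + 2 * k))"
    unfolding t_class by blast
  also have "\<dots> \<longleftrightarrow> (\<exists>k l. int (m div 2) dvd 2 * k - (1 + 2 * l))"
  proof (intro iff_exI)
    fix k l :: int
    obtain h where h: "m = 2 * h" using assms by (elim evenE)
    have "2 * k - (1 + 2 * l) - (1 + 2 * l - 2 * k) = 2 * (2 * k - (1 + 2 * l))" by simp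
    then show "t (0 + 2 * k) \<otimes> t (1 + 2 * l) = t (1 + 2 * l) \<otimes> t (0 + 2 * k)
      \<longleftrightarrow> int (m div 2) dvd 2 * k - (1 + 2 * l)"
      using dvd_mult_cancel_left[of 2 "int h" "2 * k - (1 + 2 * l)"]
      by (simp only: tt r_eq_iff cong_iff_dvd_diff h add_0) simp
  qed
  also have "\<dots> \<longleftrightarrow> odd (m div 2)"
  proof
    assume "\<exists>k l. int (m div 2) dvd 2 * k - (1 + 2 * l)"
    then obtain k l where kl: "int (m div 2) dvd 2 * k - (1 + 2 * l)" by blast
    show "odd (m div 2)"
    proof
      assume "even (m div 2)"
      then have "2 dvd 2 * k - (1 + 2 * l)" using kl by (meson dvd_trans even_of_nat)
      then show False by simp
    qed
  next
    assume "odd (m div 2)"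
    then obtain q where "m div 2 = 2 * q + 1" by (auto elim: oddE)
    \<comment> \<open>The witnesses q + 1 and 0 make the difference equal to m/2 itself.\<close>
    then have "int (m div 2) dvd 2 * (int q + 1) - (1 + 2 * 0)" by simp
    then show "\<exists>k l. int (m div 2) dvd 2 * k - (1 + 2 * l)" by blast
  qed
  finally show ?thesis .
qed

section \<open>Clique decomposition of the graph\<close>

text \<open>For odd \<open>m\<close> the two reflection classes coincide and the last set is a singleton.\<close>

definition cliques :: "'a set set set" where
  "cliques = insert rotation_classes
     (if even m \<and> even (m div 2) then {{conj_class G (t 0)}, {conj_class G (t 1)}}
      else {{conj_class G (t 0), conj_class G (t 1)}})"

lemma t_class_not_rotation: "conj_class G (t i) \<notin> rotation_classes"
proof
  assume "conj_class G (t i) \<in> rotation_classes"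
  then obtain j where "conj_class G (t i) = {r j, r (- j)}"
    by (auto simp: rotation_classes_def r_class)
  then have "r j \<in> conj_class G (t i)" by simp
  then show False using r_neq_t by (auto simp: t_class)
qed

lemma edges_CCC:
  "edges (CCC G) = {e. card e = 2 \<and> (\<exists>C\<in>cliques. e \<subseteq> C)}"
proof -
  let ?adj = "\<lambda>X Y. \<exists>x\<in>X. \<exists>y\<in>Y. x \<otimes> y = y \<otimes> x"
  let ?t0 = "conj_class G (t 0)" and ?t1 = "conj_class G (t 1)"
  have adj_sym: "?adj X Y \<longleftrightarrow> ?adj Y X" for X Y by metis
  have adj_iff: "?adj X Y \<longleftrightarrow> (\<exists>C\<in>cliques. {X, Y} \<subseteq> C)"
    if X: "X \<in> noncentral_classes G" and Y: "Y \<in> noncentral_classes G" and neq: "X \<noteq> Y" for X Y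
  proof -
    consider "X \<in> rotation_classes" "Y \<in> rotation_classes"
      | "X \<in> rotation_classes" "Y \<in> {?t0, ?t1}" | "X \<in> {?t0, ?t1}" "Y \<in> rotation_classes"
      | "X \<in> {?t0, ?t1}" "Y \<in> {?t0, ?t1}"
      using X Y unfolding noncentral_classes_eq range_t_class by blast
    then show ?thesis
    proof cases
      case 1
      then have "?adj X Y" by (auto simp: rotation_classes_def r_class rr add.commute)
      then show ?thesis using 1 by (auto simp: cliques_def)
    next
      case 2
      then have "\<not> ?adj X Y" using r_t_not_commute by (auto simp: rotation_classes_def)
      then show ?thesis using 2 t_class_not_rotation by (auto simp: cliques_def)
    next
      case 3
      then have "\<not> ?adj Y X" using r_t_not_commute by (auto simp: rotation_classes_def)
      then show ?thesis using 3 t_class_not_rotation adj_sym[of X Y] by (auto simp: cliques_def)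
    next
      case 4
      then have XY: "X = ?t0 \<and> Y = ?t1 \<or> X = ?t1 \<and> Y = ?t0" using neq by auto
      \<comment> \<open>Two distinct reflection classes exist only for even m, so the commuting
        criterion applies.\<close>
      then have "even m" using neq t_class_eq_iff[of 0 1] t_class_eq_iff[of 1 0] by auto
      then have "?adj X Y \<longleftrightarrow> odd (m div 2)"
        using XY t_class_commute_iff adj_sym[of ?t0 ?t1] by auto
      also have "\<dots> \<longleftrightarrow> (\<exists>C\<in>cliques. {X, Y} \<subseteq> C)"
        using XY neq \<open>even m\<close> t_class_not_rotation by (auto simp: cliques_def)
      finally show ?thesis .
    qed
  qed
  have sub: "X \<in> noncentral_classes G \<and> Y \<in> noncentral_classes G"
    if "\<exists>C\<in>cliques. {X, Y} \<subseteq> C" for X Y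
    using that by (auto simp: cliques_def noncentral_classes_eq split: if_splits)
  show ?thesis
  proof (rule Set.set_eqI)
    fix e
    have "e \<in> edges (CCC G) \<longleftrightarrow> (\<exists>X Y. e = {X, Y} \<and> X \<in> noncentral_classes G
      \<and> Y \<in> noncentral_classes G \<and> X \<noteq> Y \<and> ?adj X Y)"
      by (auto simp: CCC_def)
    also have "\<dots> \<longleftrightarrow> (\<exists>X Y. e = {X, Y} \<and> X \<in> noncentral_classes G
      \<and> Y \<in> noncentral_classes G \<and> X \<noteq> Y \<and> (\<exists>C\<in>cliques. {X, Y} \<subseteq> C))"
      using adj_iff by (intro iff_exI conj_cong refl) auto
    also have "\<dots> \<longleftrightarrow> (\<exists>X Y. e = {X, Y} \<and> X \<noteq> Y \<and> (\<exists>C\<in>cliques. {X, Y} \<subseteq> C))"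
      using sub by (intro iff_exI) metis
    also have "\<dots> \<longleftrightarrow> e \<in> {e. card e = 2 \<and> (\<exists>C\<in>cliques. e \<subseteq> C)}"
      by (simp only: mem_Collect_eq card_2_iff) metis
    finally show "e \<in> edges (CCC G) \<longleftrightarrow> e \<in> {e. card e = 2 \<and> (\<exists>C\<in>cliques. e \<subseteq> C)}" .
  qed
qed

sublocale clique_union "CCC G" cliques
proof
  show "finite cliques" by (simp add: cliques_def)
  \<comment> \<open>As m \<ge> 3, the cardinality (m - 1) div 2 is positive, which an infinite set
    cannot have.\<close>
  have "finite rotation_classes"
    using card_rotation_classes m_ge by (intro card_ge_0_finite) simp
  then show "finite C" if "C \<in> cliques" for C
    using that by (auto simp: cliques_def split: if_splits)
  show "disjoint cliques"
    using t_class_not_rotation t_class_eq_iff[of 0 1]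
    by (auto simp: cliques_def disjoint_def)
  show "verts (CCC G) = \<Union>cliques"
    by (auto simp: cliques_def CCC_def noncentral_classes_eq range_t_class split: if_splits)
qed (rule edges_CCC)

text \<open>With \<open>g\<close> arbitrary, one evaluation yields the vertex count, the edge count
  and both Zagreb indices.\<close>

lemma sum_cliques:
  fixes g :: "nat \<Rightarrow> nat"
  shows "(\<Sum>C\<in>cliques. g (card C)) = g ((m - 1) div 2) +
    (if odd m then g 1 else if even (m div 2) then 2 * g 1 else g 2)"
proof -
  \<comment> \<open>This keeps \<open>insert\<close> from merging two summands.\<close>
  have "rotation_classes \<noteq> {conj_class G (t 0)}" "rotation_classes \<noteq> {conj_class G (t 1)}"
    "rotation_classes \<noteq> {conj_class G (t 0), conj_class G (t 1)}"
    using t_class_not_rotation by blast+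
  moreover have "conj_class G (t 0) = conj_class G (t 1) \<longleftrightarrow> odd m"
    by (simp add: t_class_eq_iff)
  ultimately show ?thesis
    unfolding cliques_def by (cases "odd m"; cases "even (m div 2)")
      (simp_all add: card_rotation_classes numeral_2_eq_2)
qed

end

section \<open>Zagreb indices and the quotient inequality\<close>

theorem theorem2p2:
  fixes G :: "('a, 'b) monoid_scheme" and m :: nat
  assumes "m \<ge> 3" and "dihedral_group m G"
  shows
    "real (zagreb1 (CCC G)) =
       (if odd m then (real m - 1) * (real m - 3)^2 / 8
        else if even (m div 2) then (real m - 2) * (real m - 4)^2 / 8
        else (real m - 2) * (real m - 4)^2 / 8 + 2)
     \<and> real (zagreb2 (CCC G)) =
       (if odd m then (real m - 1) * (real m - 3)^3 / 32
        else if even (m div 2) then (real m - 2) * (real m - 4)^3 / 32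
        else (real m - 2) * (real m - 4)^3 / 32 + 1)
     \<and> real (zagreb2 (CCC G)) / real (card (edges (CCC G)))
         \<ge> real (zagreb1 (CCC G)) / real (card (verts (CCC G)))
     \<and> (m \<in> {3, 4, 6} \<longrightarrow>
         real (zagreb2 (CCC G)) / real (card (edges (CCC G)))
           = real (zagreb1 (CCC G)) / real (card (verts (CCC G))))"
proof -
  obtain r t where "dihedral G m r t"
    using dihedral_group_imp_dihedral[OF assms] .
  then interpret dihedral G m r t .
  \<comment> \<open>Thus k is the degree of every rotation class.\<close>
  obtain k where k: "(m - 1) div 2 = Suc k"
    using assms(1) by (cases "(m - 1) div 2") auto
  have choose: "real (Suc k choose 2) = real (k + 1) * real k / 2"
    by (simp add: choose_two real_of_nat_div algebra_simps)
  have M1: "zagreb1 (CCC G) = Suc k * k\<^sup>2 + (if odd m \<or> even (m div 2) then 0 else 2)"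
    using sum_cliques[of "\<lambda>n. n * (n - 1)\<^sup>2", unfolded k] by (simp add: zagreb1)
  have M2: "zagreb2 (CCC G) = (Suc k choose 2) * k\<^sup>2 + (if odd m \<or> even (m div 2) then 0 else 1)"
    using sum_cliques[of "\<lambda>n. (n choose 2) * (n - 1)\<^sup>2", unfolded k] by (simp add: zagreb2)
  have e: "card (edges (CCC G)) = (Suc k choose 2) + (if odd m \<or> even (m div 2) then 0 else 1)"
    using sum_cliques[of "\<lambda>n. n choose 2", unfolded k] by (simp add: card_edges)
  have v: "card (verts (CCC G)) = Suc k + (if odd m then 1 else 2)"
    using sum_cliques[of "\<lambda>n. n", unfolded k] by (simp add: card_verts)
  show ?thesis
  proof (cases "odd m \<or> even (m div 2)")
    case True
    \<comment> \<open>\<open>d\<close> counts the reflection classes, all isolated here, which lets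
      odd m and even m/2 be treated together.\<close>
    define d :: real where "d = (if odd m then 1 else 2)"
    have "m = (if odd m then 2 * k + 3 else 2 * k + 4)" using k by presburger
    then have m: "real m = 2 * real k + 2 + d" by (auto simp: d_def split: if_splits)
    have M1': "real (zagreb1 (CCC G)) = (real k + 1) * real k ^ 2"
      and M2': "real (zagreb2 (CCC G)) = (real k + 1) * real k / 2 * real k ^ 2"
      and e': "real (card (edges (CCC G))) = (real k + 1) * real k / 2"
      and v': "real (card (verts (CCC G))) = real k + 1 + d"
      using True by (simp_all only: M1 M2 e v of_nat_add of_nat_mult choose of_nat_power)
        (simp_all add: d_def)
    \<comment> \<open>For k = 0 there are no edges; division by zero gives 0, which agrees with the
      convention and with k^2.\<close>
    have quot2: "real (zagreb2 (CCC G)) / real (card (edges (CCC G))) = real k ^ 2"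
      unfolding M2' e' by (cases "k = 0") auto
    have "d > 0" by (simp add: d_def)
    then have "real k ^ 2 * ((real k + 1) / (real k + 1 + d)) \<le> real k ^ 2 * 1"
      by (intro mult_left_mono) auto
    then have ineq: "real (zagreb1 (CCC G)) / real (card (verts (CCC G))) \<le> real k ^ 2"
      by (simp add: M1' v' mult.commute)
    have eq: "real k ^ 2 = real (zagreb1 (CCC G)) / real (card (verts (CCC G)))"
      if "m \<in> {3, 4, 6}"
    proof -
      \<comment> \<open>The case m = 6 is excluded since 6/2 is odd; m = 3 and m = 4 give an
        edgeless graph.\<close>
      have "k = 0" using that True k by auto
      then show ?thesis by (simp add: M1')
    qed
    have formulas: "real (zagreb1 (CCC G)) = (real m - d) * (real m - (2 + d)) ^ 2 / 8"
      "real (zagreb2 (CCC G)) = (real m - d) * (real m - (2 + d)) ^ 3 / 32"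
      by (simp_all add: M1' M2' m power2_eq_square power3_eq_cube)
    show ?thesis
      unfolding quot2
    proof (intro conjI impI)
      show "m \<in> {3, 4, 6} \<Longrightarrow> real k ^ 2 = real (zagreb1 (CCC G)) / real (card (verts (CCC G)))"
        by (rule eq)
    qed (rule ineq | use True formulas in \<open>simp add: d_def\<close>)+
  next
    case False
    have m: "m = 2 * k + 4" using False k by presburger
    \<comment> \<open>k = 0 would mean m = 4, where m/2 is even.\<close>
    have "k \<ge> 1" using False m by (cases k) auto
    have M1': "real (zagreb1 (CCC G)) = (real k + 1) * real k ^ 2 + 2"
      and M2': "real (zagreb2 (CCC G)) = (real k + 1) * real k / 2 * real k ^ 2 + 1"
      and e': "real (card (edges (CCC G))) = (real k + 1) * real k / 2 + 1"
      and v': "real (card (verts (CCC G))) = real k + 3"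
      using False by (simp_all only: M1 M2 e v of_nat_add of_nat_mult choose of_nat_power)
        simp_all
    have cross: "p / q \<le> x / y" if "p * y \<le> x * q" "q > 0" "y > 0" for p q x y :: real
      using that by (simp add: field_simps)
    have "((real k + 1) * real k / 2 * real k ^ 2 + 1) * (real k + 3)
        - ((real k + 1) * real k ^ 2 + 2) * ((real k + 1) * real k / 2 + 1)
        = (real k + 1)\<^sup>2 * (real k - 1)\<^sup>2"
      by (simp add: power2_eq_square algebra_simps add_divide_distrib diff_divide_distrib)
    also have "\<dots> \<ge> 0" by simp
    finally have ineq: "real (zagreb1 (CCC G)) / real (card (verts (CCC G)))
        \<le> real (zagreb2 (CCC G)) / real (card (edges (CCC G)))"
      unfolding M1' M2' e' v' by (intro cross) (simp_all add: add_nonneg_pos)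
    have eq: "real (zagreb2 (CCC G)) / real (card (edges (CCC G)))
        = real (zagreb1 (CCC G)) / real (card (verts (CCC G)))" if "m \<in> {3, 4, 6}"
    proof -
      \<comment> \<open>Only m = 6 remains: the graph is two disjoint edges and both quotients are
        1.\<close>
      have "k = 1" using that m \<open>k \<ge> 1\<close> by auto
      then show ?thesis unfolding M1' M2' e' v' by simp
    qed
    have formulas: "real (zagreb1 (CCC G)) = (real m - 2) * (real m - 4) ^ 2 / 8 + 2"
      "real (zagreb2 (CCC G)) = (real m - 2) * (real m - 4) ^ 3 / 32 + 1"
      by (simp_all add: M1' M2' m power2_eq_square power3_eq_cube)
    show ?thesis
    proof (intro conjI impI)
      show "m \<in> {3, 4, 6} \<Longrightarrow> real (zagreb2 (CCC G)) / real (card (edges (CCC G)))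
        = real (zagreb1 (CCC G)) / real (card (verts (CCC G)))"
        by (rule eq)
    qed (rule ineq | use False formulas in simp)+
  qed
qed

end
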